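(* Let $D$ be a commutative Dedekind domain with an automorphism $\sigma$, let $R=D((x;\sigma))$ be the skew Laurent series ring, and let $I$ be a right ideal of $R$. Then $I\simeq \mathfrak I R$ as right $R$-modules, where $\mathfrak I=\operatorname{const}(I)$, an ideal of $D$.
   Context: A commutative Dedekind domain is a commutative domain in which every nonzero ideal is invertible (fields are allowed). The skew Laurent series ring $D((x;\sigma))$ is the set of formal series $\sum_{i=k}^\infty a_i x^i$ with $k\in\mathbb Z$, $a_i\in D$, with termwise addition and multiplication determined by $x^i a=\sigma^i(a)x^i$ for $a\in D$, $i\in\mathbb Z$. For $f=\sum_{i=k}^\infty a_ix^i\in R$ with $a_k\ne 0$, put $\operatorname{lowest}(f)=a_k$, and put $\operatorname{lowest}(0)=0$. For a right ideal $I$ of $R$, $\operatorname{const}(I)=\{\operatorname{lowest}(f)\mid f\in I\}$, which is an ideal of $D$. $\mathfrak I R$ denotes the right ideal of $R$ generated by $\mathfrak I$. *)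

theory Defs
  imports "HOL-Algebra.Algebraic_Closure_Type"
begin

unbundle fps_syntax

text \<open>
  The coefficient domain is a type of class \<^class>\<open>idom\<close>; its ideals and automorphisms are those of
  the associated ring record \<^const>\<open>ring_of_type_algebra\<close>. Invertibility of an ideal is meant in the
  field of fractions.
\<close>

definition fractional_ideal :: "'a::idom fract set \<Rightarrow> bool" where
  "fractional_ideal J \<longleftrightarrow>
     0 \<in> J \<and> (\<forall>x\<in>J. \<forall>y\<in>J. x + y \<in> J) \<and> (\<forall>d. \<forall>x\<in>J. to_fract d * x \<in> J) \<and>
     (\<exists>d. d \<noteq> 0 \<and> (\<forall>x\<in>J. to_fract d * x \<in> range to_fract))"

definition ideal_product :: "'a::comm_semiring_0 set \<Rightarrow> 'a set \<Rightarrow> 'a set" where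
  "ideal_product A B = {\<Sum>i<n. a i * b i | (n::nat) a b. \<forall>i<n. a i \<in> A \<and> b i \<in> B}"

definition invertible_ideal :: "'a::idom set \<Rightarrow> bool" where
  "invertible_ideal A \<longleftrightarrow>
     (\<exists>J. fractional_ideal J \<and> ideal_product (to_fract ` A) J = range to_fract)"

definition dedekind_domain :: "'a::idom itself \<Rightarrow> bool" where
  "dedekind_domain _ \<longleftrightarrow>
     (\<forall>A :: 'a set. ideal A ring_of_type_algebra \<and> A \<noteq> {0} \<longrightarrow> invertible_ideal A)"

definition funpow_int :: "('a \<Rightarrow> 'a) \<Rightarrow> int \<Rightarrow> 'a \<Rightarrow> 'a" where
  "funpow_int s i = (if i \<ge> 0 then s ^^ nat i else inv_into UNIV s ^^ nat (- i))"

text \<open>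
  The elements of the skew Laurent series ring are the formal Laurent series of the library, with
  the library's addition. The rule $x^i a = \sigma^i(a) x^i$ gives
  $(a x^i)(b x^j) = a \sigma^i(b) x^{i+j}$, so the coefficient of $x^n$ in a product is the sum of
  $f_i \sigma^i(g_{n-i})$, where only the indices below can contribute.
\<close>

definition skew_times :: "('a::comm_ring_1 \<Rightarrow> 'a) \<Rightarrow> 'a fls \<Rightarrow> 'a fls \<Rightarrow> 'a fls" where
  "skew_times s f g =
     Abs_fls (\<lambda>n. \<Sum>i = fls_subdegree f..n - fls_subdegree g. f $$ i * funpow_int s i (g $$ (n - i)))"

lemma skew_times_nth:
  "skew_times s f g $$ n =
     (\<Sum>i = fls_subdegree f..n - fls_subdegree g. f $$ i * funpow_int s i (g $$ (n - i)))"
  unfolding skew_times_def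
  by (rule nth_Abs_fls_lower_bound[of "fls_subdegree f + fls_subdegree g"]) auto

definition skew_laurent :: "('a::comm_ring_1 \<Rightarrow> 'a) \<Rightarrow> 'a fls ring" where
  "skew_laurent s =
     \<lparr>carrier = UNIV, monoid.mult = skew_times s, one = 1, ring.zero = 0, add = (+)\<rparr>"

lemma funpow_int_0:
  assumes "s \<in> ring_iso ring_of_type_algebra (ring_of_type_algebra :: 'a::comm_ring_1 ring)"
  shows "funpow_int s i 0 = 0"
proof -
  have "bij s" and add: "\<And>x y. s (x + y) = s x + s y"
    using assms unfolding ring_iso_def ring_hom_def ring_of_type_algebra_def by simp_all
  have "s 0 = 0" using add[of 0 0] by simp
  moreover have "inv_into UNIV s 0 = 0"
    using \<open>bij s\<close> \<open>s 0 = 0\<close> by (metis bij_inv_eq_iff)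
  moreover have "(t ^^ n) 0 = 0" if "t 0 = 0" for t :: "'a \<Rightarrow> 'a" and n
    using that by (induction n) auto
  ultimately show ?thesis by (simp add: funpow_int_def)
qed

lemma skew_laurent_commutation:
  fixes s :: "'a::comm_ring_1 \<Rightarrow> 'a"
  assumes s: "s \<in> ring_iso ring_of_type_algebra ring_of_type_algebra"
  shows "fls_X_intpow i \<otimes>\<^bsub>skew_laurent s\<^esub> fls_const a =
         fls_const (funpow_int s i a) \<otimes>\<^bsub>skew_laurent s\<^esub> fls_X_intpow i"
proof (rule fls_eqI)
  fix n
  have *: "funpow_int s 0 = (\<lambda>x. x)" by (auto simp: funpow_int_def)
  show "(fls_X_intpow i \<otimes>\<^bsub>skew_laurent s\<^esub> fls_const a) $$ n =
        (fls_const (funpow_int s i a) \<otimes>\<^bsub>skew_laurent s\<^esub> fls_X_intpow i) $$ n"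
    by (simp add: skew_laurent_def skew_times_nth funpow_int_0[OF s] * if_distrib
        if_distribR cong: if_cong)
qed

definition right_ideal :: "('b, 'm) ring_scheme \<Rightarrow> 'b set \<Rightarrow> bool" where
  "right_ideal R I \<longleftrightarrow>
     additive_subgroup I R \<and> (\<forall>a\<in>I. \<forall>r\<in>carrier R. a \<otimes>\<^bsub>R\<^esub> r \<in> I)"

definition gen_right_ideal :: "('b, 'm) ring_scheme \<Rightarrow> 'b set \<Rightarrow> 'b set" where
  "gen_right_ideal R S = \<Inter>{I. right_ideal R I \<and> S \<subseteq> I}"

text \<open>Isomorphism of right ideals as right modules.\<close>

definition right_module_iso :: "('b, 'm) ring_scheme \<Rightarrow> 'b set \<Rightarrow> 'b set \<Rightarrow> bool" where
  "right_module_iso R I J \<longleftrightarrow>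
     (\<exists>h. bij_betw h I J \<and> (\<forall>a\<in>I. \<forall>b\<in>I. h (a \<oplus>\<^bsub>R\<^esub> b) = h a \<oplus>\<^bsub>R\<^esub> h b) \<and>
          (\<forall>a\<in>I. \<forall>r\<in>carrier R. h (a \<otimes>\<^bsub>R\<^esub> r) = h a \<otimes>\<^bsub>R\<^esub> r))"

text \<open>Every coefficient of the zero series is zero, so its lowest coefficient is zero as well.\<close>

definition lowest :: "'a::zero fls \<Rightarrow> 'a" where
  "lowest f = f $$ fls_subdegree f"

definition const_ideal :: "'a::zero fls set \<Rightarrow> 'a set" where
  "const_ideal I = lowest ` I"

end

theory Submission
  imports Defs
begin

text \<open>
  Write \<open>J\<close> for the ideal of lowest coefficients of \<open>I\<close>. It is an ideal because multiplication by
  a power of \<open>x\<close> moves the lowest term of any element of \<open>I\<close> to degree \<open>0\<close> without changing its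
  coefficient. There lowest coefficients can be added, and multiplied on the right by scalars without
  a twist by \<open>\<sigma>\<close>.

  In a Dedekind domain \<open>J\<close> is zero or invertible, so it has a dual basis: elements \<open>a\<^sub>i\<close> of \<open>J\<close> and
  linear maps \<open>\<beta>\<^sub>i\<close> from \<open>J\<close> to the domain with \<open>c = \<Sum>\<^sub>i a\<^sub>i \<beta>\<^sub>i(c)\<close> for all \<open>c \<in> J\<close> (if
  \<open>1 = \<Sum>\<^sub>i a\<^sub>i b\<^sub>i\<close> with \<open>b\<^sub>i\<close> in the inverse of \<open>J\<close>, then \<open>\<beta>\<^sub>i\<close> is multiplication by \<open>b\<^sub>i\<close>). It follows
  that \<open>JR\<close> consists of all series with coefficients in \<open>J\<close> (\<open>gen_right_ideal_eq\<close>): such a series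
  \<open>g\<close> is the finite sum \<open>\<Sum>\<^sub>i a\<^sub>i \<beta>\<^sub>i(g)\<close>, with \<open>\<beta>\<^sub>i\<close> acting on each coefficient.

  Choose \<open>F\<^sub>i \<in> I\<close> without terms of negative degree and with constant term \<open>a\<^sub>i\<close>. The isomorphism
  from \<open>JR\<close> to \<open>I\<close> is \<open>g \<mapsto> \<Sum>\<^sub>i F\<^sub>i \<beta>\<^sub>i(g)\<close>. Over the field of fractions this is left multiplication
  by the series \<open>\<Sum>\<^sub>i F\<^sub>i b\<^sub>i = 1 + \<dots>\<close>, and hence it is right linear and preserves lowest terms
  (\<open>lift_nth_lowest\<close>). Preserving lowest terms makes it injective. It also makes it surjective
  (\<open>lift_surj\<close>): the lowest term of any \<open>p \<in> I\<close> lies in \<open>JR\<close>, subtracting its image from \<open>p\<close>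
  leaves an element of \<open>I\<close> of larger order, and the terms found by iterating add up to a series.
\<close>

section \<open>Arithmetic of skew Laurent series\<close>

definition vanishes_below :: "int \<Rightarrow> 'a::zero fls \<Rightarrow> bool" where
  "vanishes_below k f \<longleftrightarrow> (\<forall>n<k. f $$ n = 0)"

definition fls_monom :: "'a::zero \<Rightarrow> int \<Rightarrow> 'a fls" where
  "fls_monom a k = fls_shift (- k) (fls_const a)"

lemma fls_monom_nth: "fls_monom a k $$ n = (if n = k then a else 0)"
  by (auto simp: fls_monom_def)

lemma vanishes_below_subdegree: "vanishes_below (fls_subdegree f) f"
  by (simp add: vanishes_below_def)

lemma vanishes_below_le: "vanishes_below k f \<Longrightarrow> f \<noteq> 0 \<Longrightarrow> k \<le> fls_subdegree f"
  unfolding vanishes_below_def using nth_fls_subdegree_nonzero not_le by blast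

lemma vanishes_below_monom: "vanishes_below k (fls_monom a k)"
  by (simp add: vanishes_below_def fls_monom_nth)

locale skew_series =
  fixes s :: "'a::comm_ring_1 \<Rightarrow> 'a"
  assumes iso: "s \<in> ring_iso ring_of_type_algebra ring_of_type_algebra"
begin

abbreviation sigma_pow :: "int \<Rightarrow> 'a \<Rightarrow> 'a" where "sigma_pow \<equiv> funpow_int s"
abbreviation skew_mult :: "'a fls \<Rightarrow> 'a fls \<Rightarrow> 'a fls" (infixl "\<star>" 70)
  where "f \<star> g \<equiv> skew_times s f g"

lemma bij: "bij s"
  and s_add: "s (x + y) = s x + s y"
  and s_mult: "s (x * y) = s x * s y"
  and s_one: "s 1 = 1"
  using iso unfolding ring_iso_def ring_hom_def ring_of_type_algebra_def by simp_all

lemma s_inv [simp]: "s (inv_into UNIV s x) = x" "inv_into UNIV s (s x) = x"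
  using bij by (simp_all add: bij_is_surj surj_f_inv_f bij_is_inj)

lemma pow_zero_exp [simp]: "sigma_pow 0 x = x"
  by (simp add: funpow_int_def)

lemma pow_zero [simp]: "sigma_pow i 0 = 0"
  by (rule funpow_int_0[OF iso])

lemma pow_succ: "sigma_pow (i + 1) x = s (sigma_pow i x)"
proof (cases "i \<ge> 0")
  case True
  then show ?thesis by (simp add: funpow_int_def nat_add_distrib)
next
  case False
  then obtain k where i: "i = - int (Suc k)"
    by (metis int_cases linorder_not_less of_nat_less_0_iff)
  show ?thesis
    unfolding i by (cases k) (simp_all add: funpow_int_def nat_add_distrib)
qed

lemma pow_pred: "sigma_pow (i - 1) x = inv_into UNIV s (sigma_pow i x)"
  using pow_succ[of "i - 1" x] by simp

lemma pow_exp_add: "sigma_pow (i + j) x = sigma_pow i (sigma_pow j x)"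
proof (induction i rule: int_induct[where k = 0])
  case base
  then show ?case by simp
next
  case (step1 i)
  then show ?case using pow_succ[of "i + j" x] by (metis pow_succ add.commute add.left_commute)
next
  case (step2 i)
  then show ?case using pow_pred[of "i + j" x] by (metis pow_pred add_diff_eq add.commute)
qed

lemma pow_add: "sigma_pow i (x + y) = sigma_pow i x + sigma_pow i y"
proof (induction i rule: int_induct[where k = 0])
  case (step2 i)
  then show ?case using s_add[of "inv_into UNIV s (sigma_pow i x)" "inv_into UNIV s (sigma_pow i y)"]
    by (metis pow_pred s_inv)
qed (simp_all add: pow_succ s_add)

lemma pow_mult: "sigma_pow i (x * y) = sigma_pow i x * sigma_pow i y"
proof (induction i rule: int_induct[where k = 0])
  case (step2 i)
  then show ?case using s_mult[of "inv_into UNIV s (sigma_pow i x)" "inv_into UNIV s (sigma_pow i y)"]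
    by (metis pow_pred s_inv)
qed (simp_all add: pow_succ s_mult)

lemma pow_sum: "sigma_pow i (sum f A) = (\<Sum>x\<in>A. sigma_pow i (f x))"
  by (induction A rule: infinite_finite_induct) (simp_all add: pow_add)

lemma pow_one [simp]: "sigma_pow i 1 = 1"
proof (induction i rule: int_induct[where k = 0])
  case (step2 i)
  then show ?case by (metis pow_pred s_inv(2) s_one)
qed (simp_all add: pow_succ s_one)

text \<open>
  Sums and coefficientwise images of series may have larger order than the series they come from.
  With lower bounds in place of the exact orders, the coefficients of their products are sums over
  a common range and can be compared termwise.
\<close>

lemma skew_times_nth_bounds:
  assumes f: "vanishes_below a f" and g: "vanishes_below b g"
  shows "(f \<star> g) $$ n = (\<Sum>i = a..n - b. f $$ i * sigma_pow i (g $$ (n - i)))"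
proof (cases "f = 0 \<or> g = 0")
  case True
  then show ?thesis by (auto simp: skew_times_nth)
next
  case False
  then have "a \<le> fls_subdegree f" "b \<le> fls_subdegree g"
    using f g by (auto intro: vanishes_below_le)
  then show ?thesis
    unfolding skew_times_nth by (intro sum.mono_neutral_left) auto
qed

lemma skew_times_vanishes:
  assumes "vanishes_below a f" "vanishes_below b g"
  shows "vanishes_below (a + b) (f \<star> g)"
  unfolding vanishes_below_def by (simp add: skew_times_nth_bounds[OF assms])

lemma skew_times_nth_lowest:
  assumes "vanishes_below a f" "vanishes_below b g"
  shows "(f \<star> g) $$ (a + b) = f $$ a * sigma_pow a (g $$ b)"
  by (simp add: skew_times_nth_bounds[OF assms])

lemma skew_times_monom_nth: "(f \<star> fls_monom a k) $$ n = f $$ (n - k) * sigma_pow (n - k) a"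
proof -
  have "(f \<star> fls_monom a k) $$ n =
      (\<Sum>i = fls_subdegree f..n - k. f $$ i * sigma_pow i (fls_monom a k $$ (n - i)))"
    by (rule skew_times_nth_bounds[OF vanishes_below_subdegree vanishes_below_monom])
  also have "\<dots> = (\<Sum>i = fls_subdegree f..n - k. if i = n - k then f $$ i * sigma_pow i a else 0)"
    by (intro sum.cong) (auto simp: fls_monom_nth)
  also have "\<dots> = f $$ (n - k) * sigma_pow (n - k) a"
    by auto
  finally show ?thesis .
qed

lemma const_skew_times_nth: "(fls_const a \<star> g) $$ n = a * g $$ n"
proof -
  have "vanishes_below 0 (fls_const a)"
    by (simp add: vanishes_below_def)
  then have "(fls_const a \<star> g) $$ n =
      (\<Sum>i = 0..n - fls_subdegree g. fls_const a $$ i * sigma_pow i (g $$ (n - i)))"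
    by (rule skew_times_nth_bounds[OF _ vanishes_below_subdegree])
  also have "\<dots> = (\<Sum>i = 0..n - fls_subdegree g. if i = 0 then a * g $$ n else 0)"
    by (intro sum.cong) auto
  also have "\<dots> = a * g $$ n"
    by auto
  finally show ?thesis .
qed

lemma skew_times_add_left: "(f + g) \<star> h = f \<star> h + g \<star> h"
proof (rule fls_eqI)
  fix n
  define a where "a = min (fls_subdegree f) (fls_subdegree g)"
  have "vanishes_below a f" "vanishes_below a g" "vanishes_below a (f + g)"
    by (simp_all add: vanishes_below_def a_def)
  note b = this[THEN skew_times_nth_bounds, OF vanishes_below_subdegree]
  show "((f + g) \<star> h) $$ n = (f \<star> h + g \<star> h) $$ n"
    by (simp add: b sum.distrib algebra_simps)
qed

lemma skew_times_add_right: "f \<star> (g + h) = f \<star> g + f \<star> h"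
proof (rule fls_eqI)
  fix n
  define a where "a = min (fls_subdegree g) (fls_subdegree h)"
  have "vanishes_below a g" "vanishes_below a h" "vanishes_below a (g + h)"
    by (simp_all add: vanishes_below_def a_def)
  note b = this[THEN skew_times_nth_bounds[OF vanishes_below_subdegree]]
  show "(f \<star> (g + h)) $$ n = (f \<star> g + f \<star> h) $$ n"
    by (simp add: b sum.distrib pow_add algebra_simps)
qed

lemma skew_times_zero_left [simp]: "0 \<star> g = 0"
  using skew_times_add_left[of 0 0 g] by simp

lemma skew_times_sum_left: "sum f A \<star> g = (\<Sum>x\<in>A. f x \<star> g)"
  by (induction A rule: infinite_finite_induct) (simp_all add: skew_times_add_left)

text \<open>
  Both sides have as coefficient of \<open>x\<^sup>n\<close> the sum of
  \<open>f\<^sub>i \<sigma>\<^sup>i(g\<^sub>j) \<sigma>\<^sup>i\<^sup>+\<^sup>j(h\<^sub>k)\<close> over \<open>i + j + k = n\<close>; the left side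
  is indexed by \<open>m = i + j\<close> and \<open>i\<close>, the right side by \<open>i\<close> and \<open>j\<close>.
\<close>

lemma skew_times_assoc: "(f \<star> g) \<star> h = f \<star> (g \<star> h)"
proof (rule fls_eqI)
  fix n
  define a where "a = fls_subdegree f"
  define b where "b = fls_subdegree g"
  define c where "c = fls_subdegree h"
  have va: "vanishes_below a f" and vb: "vanishes_below b g" and vc: "vanishes_below c h"
    unfolding a_def b_def c_def by (rule vanishes_below_subdegree)+
  define t where "t i m = f $$ i * sigma_pow i (g $$ (m - i)) * sigma_pow m (h $$ (n - m))" for i m
  have "((f \<star> g) \<star> h) $$ n = (\<Sum>m = a + b..n - c. \<Sum>i = a..m - b. t i m)"
    unfolding skew_times_nth_bounds[OF skew_times_vanishes[OF va vb] vc]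
      skew_times_nth_bounds[OF va vb] t_def sum_distrib_right ..
  also have "\<dots> = (\<Sum>(m, i)\<in>Sigma {a + b..n - c} (\<lambda>m. {a..m - b}). t i m)"
    by (subst sum.Sigma) auto
  also have "\<dots> = (\<Sum>(i, j)\<in>Sigma {a..n - (b + c)} (\<lambda>i. {b..n - i - c}). t i (i + j))"
    by (rule sum.reindex_bij_witness[of _ "\<lambda>(i, j). (i + j, i)" "\<lambda>(m, i). (i, m - i)"]) auto
  also have "\<dots> = (\<Sum>i = a..n - (b + c). \<Sum>j = b..n - i - c. t i (i + j))"
    by (subst sum.Sigma) auto
  also have "\<dots> = (f \<star> (g \<star> h)) $$ n"
    unfolding skew_times_nth_bounds[OF va skew_times_vanishes[OF vb vc]]
      skew_times_nth_bounds[OF vb vc] t_def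
    by (simp add: pow_sum sum_distrib_left pow_mult pow_exp_add mult.assoc diff_diff_eq)
  finally show "((f \<star> g) \<star> h) $$ n = (f \<star> (g \<star> h)) $$ n" .
qed

section \<open>Right ideals and their lowest coefficients\<close>

text \<open>
  Negation is right multiplication by a scalar, so right ideals are characterised without a
  separate condition for negatives.
\<close>

lemma skew_times_minus_one: "f \<star> fls_monom (- 1) 0 = - f"
proof (rule fls_eqI)
  fix n
  have "sigma_pow n (- 1) = - 1"
    using pow_add[of n 1 "- 1"] by (simp add: add_eq_0_iff)
  then show "(f \<star> fls_monom (- 1) 0) $$ n = (- f) $$ n"
    by (simp add: skew_times_monom_nth)
qed

lemma add_group: "group (add_monoid (skew_laurent s))"
proof (rule groupI)
  fix x assume "x \<in> carrier (add_monoid (skew_laurent s))"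
  show "\<exists>y\<in>carrier (add_monoid (skew_laurent s)).
      y \<otimes>\<^bsub>add_monoid (skew_laurent s)\<^esub> x = \<one>\<^bsub>add_monoid (skew_laurent s)\<^esub>"
    by (rule bexI[of _ "- x"]) (simp_all add: skew_laurent_def)
qed (simp_all add: skew_laurent_def add.assoc)

lemma right_ideal_iff:
  "right_ideal (skew_laurent s) I \<longleftrightarrow>
     0 \<in> I \<and> (\<forall>f\<in>I. \<forall>g\<in>I. f + g \<in> I) \<and> (\<forall>f\<in>I. \<forall>r. f \<star> r \<in> I)" (is "?L \<longleftrightarrow> ?R")
proof
  assume L: ?L
  then have sub: "subgroup I (add_monoid (skew_laurent s))"
    by (simp add: right_ideal_def additive_subgroup_def)
  show ?R
    using subgroup.one_closed[OF sub] subgroup.m_closed[OF sub] L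
    by (simp add: right_ideal_def skew_laurent_def)
next
  assume R: ?R
  have inv: "inv\<^bsub>add_monoid (skew_laurent s)\<^esub> f = - f" for f
    by (rule group.inv_equality[OF add_group]) (simp_all add: skew_laurent_def)
  have "- f \<in> I" if "f \<in> I" for f
    using R that skew_times_minus_one[of f] by metis
  then have "subgroup I (add_monoid (skew_laurent s))"
    using R unfolding inv[symmetric]
    by (intro subgroup.intro) (auto simp: skew_laurent_def)
  then show ?L
    using R by (simp add: right_ideal_def additive_subgroup_def skew_laurent_def)
qed

end

locale skew_right_ideal = skew_series +
  fixes I
  assumes right_ideal: "right_ideal (skew_laurent s) I"
begin

lemma zero_mem: "0 \<in> I"
  and add_mem: "f \<in> I \<Longrightarrow> g \<in> I \<Longrightarrow> f + g \<in> I"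
  and times_mem: "f \<in> I \<Longrightarrow> f \<star> r \<in> I"
  using right_ideal unfolding right_ideal_iff by blast+

lemma diff_mem: "f \<in> I \<Longrightarrow> g \<in> I \<Longrightarrow> f - g \<in> I"
  using add_mem[OF _ times_mem, of f g "fls_monom (- 1) 0"] by (simp add: skew_times_minus_one)

lemma sum_mem: "(\<And>x. x \<in> A \<Longrightarrow> f x \<in> I) \<Longrightarrow> sum f A \<in> I"
  by (induction A rule: infinite_finite_induct) (simp_all add: zero_mem add_mem)

lemma nth_mem_const_ideal:
  assumes "f \<in> I" "vanishes_below k f"
  shows "f $$ k \<in> const_ideal I"
proof (cases "f $$ k = 0")
  case True
  then show ?thesis
    using imageI[OF zero_mem, of lowest] by (simp add: const_ideal_def lowest_def)
next
  case False
  then have "fls_subdegree f = k"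
    using assms(2) by (intro fls_subdegree_eqI) (auto simp: vanishes_below_def)
  then show ?thesis
    using assms(1) by (auto simp: const_ideal_def lowest_def)
qed

lemma const_ideal_iff:
  "c \<in> const_ideal I \<longleftrightarrow> (\<exists>f\<in>I. vanishes_below 0 f \<and> f $$ 0 = c)"
proof
  assume "c \<in> const_ideal I"
  then obtain f where f: "f \<in> I" "c = f $$ fls_subdegree f"
    by (auto simp: const_ideal_def lowest_def)
  define g where "g = f \<star> fls_monom 1 (- fls_subdegree f)"
  have "g \<in> I" "vanishes_below 0 g" "g $$ 0 = c"
    using f by (auto simp: g_def times_mem skew_times_monom_nth vanishes_below_def)
  then show "\<exists>f\<in>I. vanishes_below 0 f \<and> f $$ 0 = c" by blast
qed (use nth_mem_const_ideal in blast)

lemma const_ideal_zero: "0 \<in> const_ideal I"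
  using nth_mem_const_ideal[OF zero_mem, of 0] by (simp add: vanishes_below_def)

lemma const_ideal_add:
  assumes "c \<in> const_ideal I" "d \<in> const_ideal I"
  shows "c + d \<in> const_ideal I"
proof -
  obtain f g where "f \<in> I" "vanishes_below 0 f" "f $$ 0 = c"
    "g \<in> I" "vanishes_below 0 g" "g $$ 0 = d"
    using assms unfolding const_ideal_iff by blast
  then show ?thesis
    unfolding const_ideal_iff
    by (intro bexI[of _ "f + g"]) (auto simp: vanishes_below_def add_mem)
qed

lemma const_ideal_mult:
  assumes "c \<in> const_ideal I"
  shows "c * d \<in> const_ideal I"
proof -
  obtain f where "f \<in> I" "vanishes_below 0 f" "f $$ 0 = c"
    using assms unfolding const_ideal_iff by blast
  then show ?thesis
    unfolding const_ideal_iff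
    by (intro bexI[of _ "f \<star> fls_monom d 0"])
       (auto simp: vanishes_below_def times_mem skew_times_monom_nth)
qed

lemma ideal_const_ideal: "ideal (const_ideal I) ring_of_type_algebra"
proof (rule idealI)
  show "ring (ring_of_type_algebra :: 'a ring)"
    by (rule ring_from_type_algebra)
  then interpret R: ring "ring_of_type_algebra :: 'a ring" .
  have inv: "inv\<^bsub>add_monoid (ring_of_type_algebra :: 'a ring)\<^esub> c = - c" for c
    using R.minus_equality[of "- c" c] unfolding a_inv_def by (simp add: ring_of_type_algebra_def)
  have "- c \<in> const_ideal I" if "c \<in> const_ideal I" for c
    using const_ideal_mult[OF that, of "- 1"] by simp
  then show "subgroup (const_ideal I) (add_monoid ring_of_type_algebra)"
    unfolding inv[symmetric]
    by (intro subgroup.intro)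
       (auto simp: ring_of_type_algebra_def const_ideal_zero const_ideal_add)
qed (auto simp: ring_of_type_algebra_def const_ideal_mult mult.commute)

end

section \<open>Dual bases of ideals\<close>

text \<open>
  The maps \<open>\<beta> i\<close> are constrained on \<open>J\<close> only, where they are linear functionals; together with the
  generators \<open>a i\<close> they witness that \<open>J\<close> is a finitely generated projective module.
\<close>

definition dual_basis :: "'a::comm_ring_1 set \<Rightarrow> nat \<Rightarrow> (nat \<Rightarrow> 'a) \<Rightarrow> (nat \<Rightarrow> 'a \<Rightarrow> 'a) \<Rightarrow> bool" where
  "dual_basis J m a \<beta> \<longleftrightarrow>
     (\<forall>i<m. a i \<in> J) \<and>
     (\<forall>i. \<forall>c\<in>J. \<forall>d\<in>J. \<beta> i (c + d) = \<beta> i c + \<beta> i d) \<and>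
     (\<forall>i. \<forall>c\<in>J. \<forall>d. \<beta> i (c * d) = \<beta> i c * d) \<and>
     (\<forall>c\<in>J. (\<Sum>i<m. a i * \<beta> i c) = c)"

text \<open>
  Write \<open>1 = \<Sum>\<^sub>i a\<^sub>i b\<^sub>i\<close> with \<open>a\<^sub>i \<in> J\<close> and \<open>b\<^sub>i\<close> in the inverse fractional ideal. Multiplication
  by \<open>b\<^sub>i\<close> maps \<open>J\<close> into the domain, and multiplying the equation by \<open>c\<close> expands \<open>c\<close>.
\<close>

lemma invertible_ideal_dual_basis:
  assumes ideal: "ideal J ring_of_type_algebra" and inv: "invertible_ideal J"
  shows "\<exists>m a \<beta>. dual_basis J m a \<beta>"
proof -
  obtain F where F: "fractional_ideal F"
    and JF: "ideal_product (to_fract ` J) F = range to_fract"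
    using inv by (auto simp: invertible_ideal_def)
  have "to_fract 1 \<in> ideal_product (to_fract ` J) F"
    unfolding JF by blast
  then obtain m :: nat and u b where one: "1 = (\<Sum>i<m. u i * b i)"
    and ub: "\<And>i. i < m \<Longrightarrow> u i \<in> to_fract ` J \<and> b i \<in> F"
    unfolding ideal_product_def mem_Collect_eq to_fract_1 by blast
  have "\<forall>i. \<exists>x. i < m \<longrightarrow> x \<in> J \<and> u i = to_fract x"
    using ub by blast
  then obtain a where a: "\<And>i. i < m \<Longrightarrow> a i \<in> J \<and> u i = to_fract (a i)"
    by metis
  \<comment> \<open>The functionals with index at least \<open>m\<close> have to be linear with values in the domain too, so they
    are made zero.\<close>
  define b' where "b' i = (if i < m then b i else 0)" for i
  have b'F: "b' i \<in> F" for i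
    using ub F by (auto simp: b'_def fractional_ideal_def)
  define \<beta> where "\<beta> i c = (SOME d. to_fract d = to_fract c * b' i)" for i c
  have \<beta>: "to_fract (\<beta> i c) = to_fract c * b' i" if "c \<in> J" for i c
  proof -
    have "to_fract c * b' i \<in> ideal_product (to_fract ` J) F"
      unfolding ideal_product_def mem_Collect_eq using that b'F
      by (intro exI[of _ "Suc 0"] exI[of _ "\<lambda>_. to_fract c"] exI[of _ "\<lambda>_. b' i"]) simp
    then obtain d where "to_fract d = to_fract c * b' i"
      unfolding JF by auto
    then show ?thesis
      unfolding \<beta>_def by (rule someI)
  qed
  have J_add: "c + d \<in> J" if "c \<in> J" "d \<in> J" for c d
    using additive_subgroup.a_closed[OF ideal.axioms(1)[OF ideal] that]
    by (simp add: ring_of_type_algebra_def)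
  have J_mult: "c * d \<in> J" if "c \<in> J" for c d
    using ideal.I_r_closed[OF ideal that] by (simp add: ring_of_type_algebra_def)
  have "\<beta> i (c + d) = \<beta> i c + \<beta> i d" if "c \<in> J" "d \<in> J" for i c d
    by (rule to_fract_eq_iff[THEN iffD1]) (simp add: \<beta> J_add that distrib_right)
  moreover have "\<beta> i (c * d) = \<beta> i c * d" if "c \<in> J" for i c d
    by (rule to_fract_eq_iff[THEN iffD1]) (simp add: \<beta> J_mult that ac_simps)
  moreover have "(\<Sum>i<m. a i * \<beta> i c) = c" if c: "c \<in> J" for c
  proof -
    have "to_fract (\<Sum>i<m. a i * \<beta> i c) = to_fract c * (\<Sum>i<m. u i * b i)"
      unfolding to_fract_sum sum_distrib_left
      by (intro sum.cong) (auto simp: \<beta>[OF c] a b'_def)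
    also have "\<dots> = to_fract c"
      using one by simp
    finally show ?thesis
      by (rule to_fract_eq_iff[THEN iffD1])
  qed
  ultimately show ?thesis
    using a unfolding dual_basis_def by blast
qed

text \<open>The zero ideal, which is not invertible, has the empty dual basis.\<close>

lemma zero_ideal_dual_basis: "dual_basis {0} 0 (\<lambda>_. 0) (\<lambda>_ _. 0)"
  by (simp add: dual_basis_def)

lemma dedekind_dual_basis:
  assumes "dedekind_domain TYPE('a::idom)" "ideal J (ring_of_type_algebra :: 'a ring)"
  shows "\<exists>m a \<beta>. dual_basis J m a \<beta>"
proof (cases "J = {0}")
  case True
  then show ?thesis using zero_ideal_dual_basis by blast
next
  case False
  then have "invertible_ideal J"
    using assms unfolding dedekind_domain_def by blast
  then show ?thesis
    using assms(2) by (intro invertible_ideal_dual_basis)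
qed

section \<open>Lifting a dual basis to series\<close>

definition coeff_map :: "('a::zero \<Rightarrow> 'b::zero) \<Rightarrow> 'a fls \<Rightarrow> 'b fls" where
  "coeff_map \<phi> f = Abs_fls (\<lambda>n. \<phi> (f $$ n))"

lemma coeff_map_nth:
  assumes "\<phi> 0 = 0"
  shows "coeff_map \<phi> f $$ n = \<phi> (f $$ n)"
  unfolding coeff_map_def
  by (rule nth_Abs_fls_lower_bound[of "fls_subdegree f"]) (simp add: assms)

definition coeffs_in :: "'a::zero set \<Rightarrow> 'a fls set" where
  "coeffs_in J = {f. \<forall>n. f $$ n \<in> J}"

text \<open>
  The series \<open>F i\<close> replace the generators \<open>a i\<close> of the ideal of lowest coefficients by elements of
  \<open>I\<close> having them as constant terms.
\<close>

locale lifted_dual_basis = skew_right_ideal +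
  fixes m :: nat and a :: "nat \<Rightarrow> 'a" and \<beta> :: "nat \<Rightarrow> 'a \<Rightarrow> 'a" and F :: "nat \<Rightarrow> 'a fls"
  assumes dual_basis: "dual_basis (const_ideal I) m a \<beta>"
    and F_mem: "i < m \<Longrightarrow> F i \<in> I"
    and F_vanishes: "i < m \<Longrightarrow> vanishes_below 0 (F i)"
    and F_lowest: "i < m \<Longrightarrow> F i $$ 0 = a i"
begin

abbreviation J :: "'a set" where "J \<equiv> const_ideal I"
abbreviation JR :: "'a fls set" where "JR \<equiv> coeffs_in J"

lemma a_mem: "i < m \<Longrightarrow> a i \<in> J"
  and \<beta>_add: "c \<in> J \<Longrightarrow> d \<in> J \<Longrightarrow> \<beta> i (c + d) = \<beta> i c + \<beta> i d"
  and \<beta>_mult: "c \<in> J \<Longrightarrow> \<beta> i (c * e) = \<beta> i c * e"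
  and expand: "c \<in> J \<Longrightarrow> (\<Sum>i<m. a i * \<beta> i c) = c"
  using dual_basis by (simp_all add: dual_basis_def)

lemma \<beta>_zero [simp]: "\<beta> i 0 = 0"
  using \<beta>_mult[OF const_ideal_zero, of i 0] by simp

lemma J_sum: "(\<And>x. x \<in> A \<Longrightarrow> f x \<in> J) \<Longrightarrow> sum f A \<in> J"
  by (induction A rule: infinite_finite_induct) (simp_all add: const_ideal_zero const_ideal_add)

lemma \<beta>_sum: "(\<And>x. x \<in> A \<Longrightarrow> f x \<in> J) \<Longrightarrow> \<beta> i (sum f A) = (\<Sum>x\<in>A. \<beta> i (f x))"
  by (induction A rule: infinite_finite_induct) (simp_all add: \<beta>_add J_sum)

abbreviation B :: "nat \<Rightarrow> 'a fls \<Rightarrow> 'a fls" where "B i \<equiv> coeff_map (\<beta> i)"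

lemma B_nth [simp]: "B i g $$ n = \<beta> i (g $$ n)"
  by (rule coeff_map_nth) simp

lemma B_vanishes: "vanishes_below k g \<Longrightarrow> vanishes_below k (B i g)"
  by (simp add: vanishes_below_def)

lemma B_add: "f \<in> JR \<Longrightarrow> g \<in> JR \<Longrightarrow> B i (f + g) = B i f + B i g"
  by (rule fls_eqI) (simp add: coeffs_in_def \<beta>_add)

text \<open>
  Right multiplication by \<open>r\<close> multiplies the coefficients of \<open>g\<close> by scalars, namely twisted coefficients
  of \<open>r\<close>, and \<open>\<beta> i\<close> commutes with every scalar.
\<close>

lemma B_times:
  assumes "g \<in> JR"
  shows "B i (g \<star> r) = B i g \<star> r"
proof (rule fls_eqI)
  fix n
  have g: "g $$ k \<in> J" for k
    using assms by (simp add: coeffs_in_def)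
  show "B i (g \<star> r) $$ n = (B i g \<star> r) $$ n"
    unfolding B_nth skew_times_nth_bounds[OF vanishes_below_subdegree vanishes_below_subdegree, of g r]
      skew_times_nth_bounds[OF B_vanishes[OF vanishes_below_subdegree] vanishes_below_subdegree, of i g r]
    by (simp add: \<beta>_sum \<beta>_mult const_ideal_mult g)
qed

lemma right_ideal_JR: "right_ideal (skew_laurent s) JR"
  unfolding right_ideal_iff coeffs_in_def
  by (auto simp: const_ideal_zero const_ideal_add skew_times_nth intro!: J_sum const_ideal_mult)

text \<open>
  That every series with coefficients in \<open>J\<close> lies in the right ideal generated by \<open>J\<close> uses that \<open>J\<close>
  is finitely generated: the dual basis writes all coefficients in terms of the same finitely many
  generators.
\<close>

lemma gen_right_ideal_eq: "gen_right_ideal (skew_laurent s) (fls_const ` J) = JR"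
proof
  show "gen_right_ideal (skew_laurent s) (fls_const ` J) \<subseteq> JR"
    unfolding gen_right_ideal_def using right_ideal_JR
    by (intro Inter_lower) (auto simp: coeffs_in_def const_ideal_zero)
next
  show "JR \<subseteq> gen_right_ideal (skew_laurent s) (fls_const ` J)"
    unfolding gen_right_ideal_def
  proof (intro subsetI InterI, clarify)
    fix g K
    assume g: "g \<in> JR" and K: "right_ideal (skew_laurent s) K" "fls_const ` J \<subseteq> K"
    interpret K: skew_right_ideal s K
      by unfold_locales (rule K)
    have "g = (\<Sum>i<m. fls_const (a i) \<star> B i g)"
      using g by (intro fls_eqI) (simp add: fls_nth_sum const_skew_times_nth expand coeffs_in_def)
    also have "\<dots> \<in> K"
      using K(2) a_mem by (intro K.sum_mem K.times_mem) auto
    finally show "g \<in> K" .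
  qed
qed

definition lift :: "'a fls \<Rightarrow> 'a fls" where
  "lift g = (\<Sum>i<m. F i \<star> B i g)"

lemma lift_mem: "lift g \<in> I"
  unfolding lift_def by (intro sum_mem times_mem F_mem) simp

lemma lift_add: "f \<in> JR \<Longrightarrow> g \<in> JR \<Longrightarrow> lift (f + g) = lift f + lift g"
  by (simp add: lift_def B_add skew_times_add_right sum.distrib)

lemma lift_times: "g \<in> JR \<Longrightarrow> lift (g \<star> r) = lift g \<star> r"
  by (simp add: lift_def B_times skew_times_sum_left skew_times_assoc)

lemma lift_vanishes:
  assumes "vanishes_below k g"
  shows "vanishes_below k (lift g)"
proof -
  have "vanishes_below k (F i \<star> B i g)" if "i < m" for i
    using skew_times_vanishes[OF F_vanishes[OF that] B_vanishes[OF assms]] by simp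
  then show ?thesis
    by (simp add: vanishes_below_def lift_def fls_nth_sum)
qed

text \<open>
  The product of \<open>F i\<close> and \<open>B i g\<close> has \<open>a i * \<beta> i (g $$ k)\<close> in degree \<open>k\<close>, and by the defining
  property of a dual basis these add up to \<open>g $$ k\<close>.
\<close>

lemma lift_nth_lowest:
  assumes "vanishes_below k g" "g \<in> JR"
  shows "lift g $$ k = g $$ k"
proof -
  have "(F i \<star> B i g) $$ k = a i * \<beta> i (g $$ k)" if "i < m" for i
    using skew_times_nth_lowest[OF F_vanishes[OF that] B_vanishes[OF assms(1)]]
    by (simp add: F_lowest that)
  then show ?thesis
    using assms(2) by (simp add: lift_def fls_nth_sum expand coeffs_in_def)
qed

sublocale JR: skew_right_ideal s JR
  by unfold_locales (rule right_ideal_JR)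

lemma lift_diff:
  assumes "f \<in> JR" "g \<in> JR"
  shows "lift (f - g) = lift f - lift g"
  using lift_add[OF JR.diff_mem[OF assms] assms(2)] by simp

lemma inj_lift: "inj_on lift JR"
proof (rule inj_onI)
  fix f g assume fg: "f \<in> JR" "g \<in> JR" "lift f = lift g"
  have "lift (f - g) $$ fls_subdegree (f - g) = 0"
    using fg by (simp add: lift_diff)
  then have "(f - g) $$ fls_subdegree (f - g) = 0"
    using lift_nth_lowest[OF vanishes_below_subdegree JR.diff_mem] fg by metis
  then show "f = g"
    using nth_fls_subdegree_zero_iff[of "f - g"] by simp
qed

text \<open>
  Successive approximation: \<open>G j\<close> is a preimage of \<open>p\<close> up to degree \<open>k + j\<close>, obtained by adding at
  each step the lowest term of the error. The coefficients of \<open>G j\<close> below degree \<open>k + j\<close> never change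
  again, so they define a limit, and \<open>lift_vanishes\<close> carries the agreement of the limit with \<open>G j\<close>
  over to the images.
\<close>

lemma lift_surj: "I \<subseteq> lift ` JR"
proof
  fix p assume p: "p \<in> I"
  define k where "k = fls_subdegree p"
  define G where "G = rec_nat 0 (\<lambda>j G. G + fls_monom ((p - lift G) $$ (k + int j)) (k + int j))"
  have G_Suc: "G (Suc j) = G j + fls_monom ((p - lift (G j)) $$ (k + int j)) (k + int j)" for j
    by (simp add: G_def)
  have approx: "G j \<in> JR \<and> vanishes_below (k + int j) (p - lift (G j))" for j
  proof (induction j)
    case 0
    have "lift 0 = 0"
      using lift_add[OF JR.zero_mem JR.zero_mem] by simp
    then show ?case
      using JR.zero_mem by (simp add: G_def k_def vanishes_below_subdegree)
  next
    case (Suc j)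
    define q where "q = p - lift (G j)"
    define t where "t = fls_monom (q $$ (k + int j)) (k + int j)"
    have q: "vanishes_below (k + int j) q" "q \<in> I"
      using Suc p lift_mem by (simp_all add: q_def diff_mem)
    have t: "t \<in> JR" "vanishes_below (k + int j) t"
      using nth_mem_const_ideal[OF q(2,1)]
      by (simp_all add: t_def coeffs_in_def fls_monom_nth const_ideal_zero vanishes_below_monom)
    have GS: "G (Suc j) = G j + t"
      by (simp add: G_Suc t_def q_def)
    have "p - lift (G (Suc j)) = q - lift t"
      using Suc t by (simp add: GS lift_add q_def)
    moreover have "(q - lift t) $$ n = 0" if "n < k + int (Suc j)" for n
    proof (cases "n = k + int j")
      case True
      then show ?thesis
        using lift_nth_lowest[OF t(2,1)] by (simp add: t_def fls_monom_nth)
    next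
      case False
      then show ?thesis
        using that q(1) lift_vanishes[OF t(2)] by (simp add: vanishes_below_def)
    qed
    ultimately show ?case
      using Suc t JR.add_mem by (simp add: GS vanishes_below_def)
  qed
  define g where "g = Abs_fls (\<lambda>n. if n < k then 0 else G (Suc (nat (n - k))) $$ n)"
  have g_nth: "g $$ n = (if n < k then 0 else G (Suc (nat (n - k))) $$ n)" for n
    unfolding g_def by (rule nth_Abs_fls_lower_bound[of k]) simp
  have g: "g \<in> JR"
    using approx by (simp add: coeffs_in_def g_nth const_ideal_zero)
  have stable: "G (j + l) $$ n = G j $$ n" if "n < k + int j" for j l n
    by (induction l) (use that in \<open>simp_all add: G_Suc fls_monom_nth\<close>)
  have G_below: "G j $$ n = 0" if "n < k" for j n
    using stable[of n 0 j] that by (simp add: G_def)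
  have "lift g = p"
  proof (rule fls_eqI)
    fix n
    \<comment> \<open>Any \<open>j\<close> with \<open>n < k + j\<close> would do.\<close>
    define j where "j = Suc (nat (n - k))"
    have "vanishes_below (k + int j) (g - G j)"
      unfolding vanishes_below_def
    proof (intro allI impI)
      fix i assume i: "i < k + int j"
      show "(g - G j) $$ i = 0"
      proof (cases "i < k")
        case False
        then have "G (Suc (nat (i - k)) + (j - Suc (nat (i - k)))) $$ i = G (Suc (nat (i - k))) $$ i"
          by (intro stable) simp
        then show ?thesis
          using False i by (simp add: g_nth)
      qed (simp add: g_nth G_below)
    qed
    then have "lift (g - G j) $$ n = 0"
      using lift_vanishes unfolding vanishes_below_def by (simp add: j_def)
    moreover have "(p - lift (G j)) $$ n = 0"
      using approx[of j] by (simp add: vanishes_below_def j_def)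
    ultimately show "lift g $$ n = p $$ n"
      using approx[of j] g by (simp add: lift_diff)
  qed
  then show "p \<in> lift ` JR"
    using g by blast
qed

lemma bij_lift: "bij_betw lift JR I"
  using inj_lift lift_surj lift_mem by (auto simp: bij_betw_def)

lemma right_module_iso_JR: "right_module_iso (skew_laurent s) I JR"
proof -
  define k where "k = the_inv_into JR lift"
  have k: "bij_betw k I JR"
    unfolding k_def by (rule bij_betw_the_inv_into[OF bij_lift])
  have kI: "k p \<in> JR" and hk: "lift (k p) = p" if "p \<in> I" for p
    using k that f_the_inv_into_f_bij_betw[OF bij_lift] by (auto simp: k_def bij_betw_def)
  have kh: "k (lift g) = g" if "g \<in> JR" for g
    unfolding k_def using inj_lift that by (rule the_inv_into_f_f)
  have "k (p + q) = k p + k q" if "p \<in> I" "q \<in> I" for p q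
    using kh[of "k p + k q"] that by (simp add: lift_add kI hk JR.add_mem)
  moreover have "k (p \<star> r) = k p \<star> r" if "p \<in> I" for p r
    using kh[of "k p \<star> r"] that by (simp add: lift_times kI hk JR.times_mem)
  ultimately show ?thesis
    using k unfolding right_module_iso_def skew_laurent_def by auto
qed

end

theorem proposition3p1:
  fixes \<sigma> :: "'a::idom \<Rightarrow> 'a" and I :: "'a fls set"
  assumes "dedekind_domain TYPE('a)"
    and "\<sigma> \<in> ring_iso ring_of_type_algebra ring_of_type_algebra"
    and "right_ideal (skew_laurent \<sigma>) I"
  shows "ideal (const_ideal I) ring_of_type_algebra \<and>
    right_module_iso (skew_laurent \<sigma>) I
      (gen_right_ideal (skew_laurent \<sigma>) (fls_const ` const_ideal I))"
proof -
  interpret skew_right_ideal \<sigma> I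
    using assms(2,3) by unfold_locales
  obtain m a \<beta> where db: "dual_basis (const_ideal I) m a \<beta>"
    using dedekind_dual_basis[OF assms(1) ideal_const_ideal] by blast
  have "\<forall>i. \<exists>f. i < m \<longrightarrow> f \<in> I \<and> vanishes_below 0 f \<and> f $$ 0 = a i"
    using db const_ideal_iff unfolding dual_basis_def by metis
  then obtain F where "\<And>i. i < m \<Longrightarrow> F i \<in> I \<and> vanishes_below 0 (F i) \<and> F i $$ 0 = a i"
    by metis
  with db interpret lifted_dual_basis \<sigma> I m a \<beta> F
    by unfold_locales auto
  show ?thesis
    using ideal_const_ideal right_module_iso_JR gen_right_ideal_eq by simp
qed

end
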